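(* Let $\mathcal X=\xi\frac{\partial}{\partial x}+\sum_{(L,\alpha)}\eta^\alpha_L\frac{\partial}{\partial y^\alpha_L}$ be a Lie-Bäcklund field in $J^\infty(\mathbb R,\mathbb R^2)$ such that $\xi,\eta^0_1,\eta^0_2$ do not depend on $y^\gamma_K$ for $\gamma\ge2$, $K=1,2$. For $\mathcal X$ to be exponentiable to a flow $\Phi_t=(\Xi_t,H^\alpha_{Lt})$ such that $\Xi_t$ and $H^0_{Lt}$ ($L=1,2$) do not depend on $y^\gamma_K$, $\gamma\ge2$, $K=1,2$, it is necessary that $$\text{(i)}\quad \sum_{P=1}^2M^R_P\frac{\partial\xi}{\partial y^1_P}=0,\qquad \sum_{P=1}^2M^R_P\frac{\partial\eta^0_L}{\partial y^1_P}=0,\qquad L,R=1,2,$$ and $$\text{(ii)}\quad \sum_{P=1}^2Q^R_P\frac{\partial\xi}{\partial y^1_P}=0,\qquad \sum_{P=1}^2Q^R_P\frac{\partial\eta^0_L}{\partial y^1_P}=0,\qquad L,R=1,2.$$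
   Context: $J^\infty(\mathbb R,\mathbb R^2)$ has coordinates $x$ and $y^\alpha_L$, $L\in\{1,2\}$, $\alpha\in\mathbb Z_{\ge0}$ (superscripts are derivative orders, not powers). Functions on (open parts of) it are $C^\infty$ functions of finitely many coordinates; vector fields have such coefficients. $\mathbb D=\frac{\partial}{\partial x}+\sum_{L,\alpha}y_L^{\alpha+1}\frac{\partial}{\partial y^\alpha_L}$. The field $\mathcal X$ is Lie-Bäcklund if $\eta^{\alpha+1}_L=\mathbb D\eta^\alpha_L-y^{\alpha+1}_L\mathbb D\xi$ for all $L,\alpha$. It is exponentiable to the flow $\Phi_t=(\Xi_t,H^\alpha_{Lt})$ if $\Phi_t$ is a local map in (point, $t$) whose components are smooth, each depending on a finite set of coordinates that can be chosen independent of $t$, with $\Phi_0=\mathrm{id}$, $\Phi_t\circ\Phi_s=\Phi_{t+s}$, $\frac{d}{dt}\Xi_t|_{t=0}=\xi$, $\frac{d}{dt}H^\alpha_{Lt}|_{t=0}=\eta^\alpha_L$ (identities between local maps are understood where defined). Define, for $L,K\in\{1,2\}$, $$O_L=\frac{\partial\eta^0_L}{\partial x}-y^1_L\frac{\partial\xi}{\partial x},\qquad N^K_L=\frac{\partial\eta^0_L}{\partial y^0_K}-y^1_L\frac{\partial\xi}{\partial y^0_K},\qquad M^K_L=\frac{\partial\eta^0_L}{\partial y^1_K}-y^1_L\frac{\partial\xi}{\partial y^1_K},$$ and, for $R,P\in\{1,2\}$, with $J,K,S$ summed over $\{1,2\}$, $$Q^R_P=\xi\frac{\partial M^R_P}{\partial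 x}+\sum_K\eta^0_K\frac{\partial M^R_P}{\partial y^0_K}+\sum_K\Big(O_K+\sum_Jy^1_JN^J_K\Big)\frac{\partial M^R_P}{\partial y^1_K}-\Big(\sum_SM^R_S\frac{\partial O_P}{\partial y^1_S}+\sum_JM^R_JN^J_P+\sum_{S,J}M^R_S\,y^1_J\frac{\partial N^J_P}{\partial y^1_S}\Big).$$ *)

theory Defs
  imports "HOL-Analysis.Analysis"
begin

(* Real functions on a space of points 'i => real, where the index type 'i names the
   coordinates and may be infinite; this space carries the product topology. *)

definition partial :: "'i \<Rightarrow> (('i \<Rightarrow> real) \<Rightarrow> real) \<Rightarrow> ('i \<Rightarrow> real) \<Rightarrow> real" where
  "partial i f p = deriv (\<lambda>s. f (p(i := s))) (p i)"

(* All iterated partial derivatives exist and are continuous. It is used below only for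
   functions of finitely many coordinates on open sets, where it is the usual C-infinity. *)
definition C_infinity_on :: "('i \<Rightarrow> real) set \<Rightarrow> (('i \<Rightarrow> real) \<Rightarrow> real) \<Rightarrow> bool" where
  "C_infinity_on U f \<longleftrightarrow>
     (\<forall>is. continuous_on U (foldr partial is f) \<and>
           (\<forall>p\<in>U. \<forall>i. (\<lambda>s. foldr partial is f (p(i := s))) differentiable (at (p i))))"

definition depends_only_on :: "('i \<Rightarrow> real) set \<Rightarrow> 'i set \<Rightarrow> (('i \<Rightarrow> real) \<Rightarrow> real) \<Rightarrow> bool" where
  "depends_only_on U S f \<longleftrightarrow> (\<forall>p\<in>U. \<forall>q\<in>U. (\<forall>i\<in>S. p i = q i) \<longrightarrow> f p = f q)"

(* Y L a is the a-th derivative of the L-th dependent variable. The index type 2 has exactly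
   the two elements 1 and 2 (and 2 = 0 there). *)
datatype coord = X | Y 2 nat

type_synonym jet = "coord \<Rightarrow> real"

definition smooth_fun_on :: "jet set \<Rightarrow> (jet \<Rightarrow> real) \<Rightarrow> bool" where
  "smooth_fun_on U f \<longleftrightarrow> C_infinity_on U f \<and> (\<exists>S. finite S \<and> depends_only_on U S f)"

definition higher_coords :: "coord set" where
  "higher_coords = {Y K \<gamma> |K \<gamma>. \<gamma> \<ge> 2}"

(* For a function of finitely many coordinates on an open set, only finitely many partial
   derivatives at a point are nonzero, so the sum is a genuine finite sum. *)
definition total_deriv :: "(jet \<Rightarrow> real) \<Rightarrow> jet \<Rightarrow> real" where
  "total_deriv f p =
     partial X f p +
     (\<Sum>(L, \<alpha>) | partial (Y L \<alpha>) f p \<noteq> 0. p (Y L (Suc \<alpha>)) * partial (Y L \<alpha>) f p)"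

(* The field with coefficient \<xi> at d/dx and \<eta> L a at d/dy for the coordinate Y L a. *)
definition vector_field_on ::
  "jet set \<Rightarrow> (jet \<Rightarrow> real) \<Rightarrow> (2 \<Rightarrow> nat \<Rightarrow> jet \<Rightarrow> real) \<Rightarrow> bool" where
  "vector_field_on U \<xi> \<eta> \<longleftrightarrow> smooth_fun_on U \<xi> \<and> (\<forall>L \<alpha>. smooth_fun_on U (\<eta> L \<alpha>))"

definition Lie_Baecklund_on ::
  "jet set \<Rightarrow> (jet \<Rightarrow> real) \<Rightarrow> (2 \<Rightarrow> nat \<Rightarrow> jet \<Rightarrow> real) \<Rightarrow> bool" where
  "Lie_Baecklund_on U \<xi> \<eta> \<longleftrightarrow> vector_field_on U \<xi> \<eta> \<and>
     (\<forall>L \<alpha>. \<forall>p\<in>U. \<eta> L (Suc \<alpha>) p =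
        total_deriv (\<eta> L \<alpha>) p - p (Y L (Suc \<alpha>)) * total_deriv \<xi> p)"

(* The local map (p, t) |-> \<Phi> t p is defined on the open set W. Its components are
   \<Phi> t p X and \<Phi> t p (Y L a). Joint smoothness in (p, t) is smoothness on a space with one
   more coordinate: index None is t, index Some c is the coordinate c of p. The composition
   law is required wherever both of its sides are defined. *)
definition exponentiable_to ::
  "jet set \<Rightarrow> (jet \<Rightarrow> real) \<Rightarrow> (2 \<Rightarrow> nat \<Rightarrow> jet \<Rightarrow> real) \<Rightarrow>
     (jet \<times> real) set \<Rightarrow> (real \<Rightarrow> jet \<Rightarrow> jet) \<Rightarrow> bool" where
  "exponentiable_to U \<xi> \<eta> W \<Phi> \<longleftrightarrow>
     open W \<and> U \<times> {0} \<subseteq> W \<and>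
     (\<forall>c. C_infinity_on {q. (q \<circ> Some, q None) \<in> W} (\<lambda>q. \<Phi> (q None) (q \<circ> Some) c)) \<and>
     (\<forall>c. \<exists>S. finite S \<and> (\<forall>t. depends_only_on {p. (p, t) \<in> W} S (\<lambda>p. \<Phi> t p c))) \<and>
     (\<forall>p. (p, 0) \<in> W \<longrightarrow> \<Phi> 0 p = p) \<and>
     (\<forall>p s t. (p, s) \<in> W \<and> (\<Phi> s p, t) \<in> W \<and> (p, t + s) \<in> W \<longrightarrow>
        \<Phi> t (\<Phi> s p) = \<Phi> (t + s) p) \<and>
     (\<forall>p\<in>U. ((\<lambda>t. \<Phi> t p X) has_real_derivative \<xi> p) (at 0)) \<and>
     (\<forall>p\<in>U. \<forall>L \<alpha>. ((\<lambda>t. \<Phi> t p (Y L \<alpha>)) has_real_derivative \<eta> L \<alpha> p) (at 0))"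

definition coefO :: "(jet \<Rightarrow> real) \<Rightarrow> (2 \<Rightarrow> nat \<Rightarrow> jet \<Rightarrow> real) \<Rightarrow> 2 \<Rightarrow> jet \<Rightarrow> real" where
  "coefO \<xi> \<eta> L p = partial X (\<eta> L 0) p - p (Y L 1) * partial X \<xi> p"

(* In coefN and coefM the upper index K precedes the lower index L; in coefQ likewise R, P. *)
definition coefN :: "(jet \<Rightarrow> real) \<Rightarrow> (2 \<Rightarrow> nat \<Rightarrow> jet \<Rightarrow> real) \<Rightarrow> 2 \<Rightarrow> 2 \<Rightarrow> jet \<Rightarrow> real" where
  "coefN \<xi> \<eta> K L p = partial (Y K 0) (\<eta> L 0) p - p (Y L 1) * partial (Y K 0) \<xi> p"

definition coefM :: "(jet \<Rightarrow> real) \<Rightarrow> (2 \<Rightarrow> nat \<Rightarrow> jet \<Rightarrow> real) \<Rightarrow> 2 \<Rightarrow> 2 \<Rightarrow> jet \<Rightarrow> real" where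
  "coefM \<xi> \<eta> K L p = partial (Y K 1) (\<eta> L 0) p - p (Y L 1) * partial (Y K 1) \<xi> p"

definition coefQ :: "(jet \<Rightarrow> real) \<Rightarrow> (2 \<Rightarrow> nat \<Rightarrow> jet \<Rightarrow> real) \<Rightarrow> 2 \<Rightarrow> 2 \<Rightarrow> jet \<Rightarrow> real" where
  "coefQ \<xi> \<eta> R P p =
     \<xi> p * partial X (coefM \<xi> \<eta> R P) p
     + (\<Sum>K\<in>UNIV. \<eta> K 0 p * partial (Y K 0) (coefM \<xi> \<eta> R P) p)
     + (\<Sum>K\<in>UNIV. (coefO \<xi> \<eta> K p + (\<Sum>J\<in>UNIV. p (Y J 1) * coefN \<xi> \<eta> J K p))
                    * partial (Y K 1) (coefM \<xi> \<eta> R P) p)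
     - ((\<Sum>S\<in>UNIV. coefM \<xi> \<eta> R S p * partial (Y S 1) (coefO \<xi> \<eta> P) p)
        + (\<Sum>J\<in>UNIV. coefM \<xi> \<eta> R J p * coefN \<xi> \<eta> J P p)
        + (\<Sum>S\<in>UNIV. \<Sum>J\<in>UNIV.
             coefM \<xi> \<eta> R S p * p (Y J 1) * partial (Y S 1) (coefN \<xi> \<eta> J P) p))"

end

theory Submission
  imports Defs
begin

text \<open>Along an orbit every component \<open>c\<close> of the flow satisfies \<open>d/dt (\<Phi> t p c) = x\<^sub>c (\<Phi> t p)\<close>, where
  \<open>x\<^sub>c\<close> is the corresponding coefficient of the field \<open>\<X>\<close>, hence
  \<open>d/dt h (\<Phi> t p) = (\<X> h) (\<Phi> t p)\<close> for every \<open>h\<close>. If the components \<open>\<Xi>\<close> and \<open>H\<^sub>L\<close> of the flow do not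
  depend on the second derivatives, then neither do their \<open>t\<close>-derivatives at \<open>0\<close>, that is, \<open>f\<close>, \<open>\<X> f\<close>
  and \<open>\<X> (\<X> f)\<close> for \<open>f\<close> one of \<open>\<xi>\<close>, \<open>\<eta>\<^sub>1\<close>, \<open>\<eta>\<^sub>2\<close>. On functions of order at most one the prolongation
  formula gives \<open>\<X> = A + \<Sum>\<^sub>R y\<^sub>R\<^sup>2 V\<^sub>R\<close>, where \<open>V\<^sub>R = \<Sum>\<^sub>P M\<^sup>R\<^sub>P \<partial>/\<partial>y\<^sub>P\<^sup>1\<close> and \<open>A\<close> is free of second derivatives.
  Hence \<open>V\<^sub>R f = 0\<close>, which is (i), so \<open>\<X> f = A f\<close> and also \<open>V\<^sub>R (A f) = 0\<close>. Therefore
  \<open>[A, V\<^sub>R] f = 0\<close>; since \<open>V\<^sub>R\<close> annihilates \<open>\<xi>\<close> and \<open>\<eta>\<^sub>L\<close>, only the \<open>\<partial>/\<partial>y\<^sub>P\<^sup>1\<close> components of this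
  commutator survive, and they are \<open>Q\<^sup>R\<^sub>P\<close>: this is (ii).\<close>

subsection \<open>Calculus in coordinates\<close>

text \<open>A basic open set restricts only finitely many coordinates, so one radius serves for all
  of them.\<close>

lemma open_contains_box:
  fixes U :: "('i \<Rightarrow> real) set"
  assumes "open U" "p \<in> U"
  obtains T e where "finite T" "e > 0" "\<And>q. (\<And>i. i \<in> T \<Longrightarrow> \<bar>q i - p i\<bar> < e) \<Longrightarrow> q \<in> U"
proof -
  obtain B where B: "p \<in> (\<Pi>\<^sub>E i\<in>UNIV. B i)" "\<And>i. open (B i)"
      "finite {i. B i \<noteq> UNIV}" "(\<Pi>\<^sub>E i\<in>UNIV. B i) \<subseteq> U"
    using product_topology_open_contains_basis[of "\<lambda>_. euclidean" UNIV U p] assms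
    by (auto simp: open_fun_def)
  define T where "T = {i. B i \<noteq> UNIV}"
  have "\<forall>i. \<exists>e>0. \<forall>y. \<bar>y - p i\<bar> < e \<longrightarrow> y \<in> B i"
    using B(1,2) by (metis PiE_mem UNIV_I dist_real_def open_dist)
  then obtain d where d: "\<And>i. d i > 0" "\<And>i y. \<bar>y - p i\<bar> < d i \<Longrightarrow> y \<in> B i"
    by metis
  \<comment> \<open>The inserted 1 keeps the minimum meaningful when no coordinate is
    restricted.\<close>
  define e where "e = Min (insert 1 (d ` T))"
  have fin: "finite T" using B(3) by (simp add: T_def)
  have "e > 0" unfolding e_def using fin d(1) by auto
  moreover have "q \<in> U" if "\<And>i. i \<in> T \<Longrightarrow> \<bar>q i - p i\<bar> < e" for q
  proof -
    have "q i \<in> B i" for i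
    proof (cases "i \<in> T")
      case True
      then have "e \<le> d i" unfolding e_def using fin by auto
      then show ?thesis using that[OF True] d(2) by force
    qed (simp add: T_def)
    then show ?thesis using B(4) by auto
  qed
  ultimately show ?thesis using that fin by blast
qed

lemma tendsto_coordinatewise:
  fixes g :: "'a \<Rightarrow> 'i \<Rightarrow> real"
  assumes "\<And>i. ((\<lambda>x. g x i) \<longlongrightarrow> l i) F"
  shows "(g \<longlongrightarrow> l) F"
proof (rule topological_tendstoI)
  fix S :: "('i \<Rightarrow> real) set"
  assume "open S" "l \<in> S"
  then obtain T e where T: "finite T" "e > 0" "\<And>q. (\<And>i. i \<in> T \<Longrightarrow> \<bar>q i - l i\<bar> < e) \<Longrightarrow> q \<in> S"
    using open_contains_box by blast
  have "\<forall>\<^sub>F x in F. \<forall>i\<in>T. \<bar>g x i - l i\<bar> < e"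
    using assms T(1,2) by (intro eventually_ball_finite) (auto simp: tendsto_iff dist_real_def)
  then show "\<forall>\<^sub>F x in F. g x \<in> S"
    by eventually_elim (use T(3) in blast)
qed

lemma tendsto_fun_upd:
  fixes g :: "'a \<Rightarrow> 'i \<Rightarrow> real"
  assumes "\<And>j. ((\<lambda>x. g x j) \<longlongrightarrow> p j) F" "(u \<longlongrightarrow> p i) F"
  shows "((\<lambda>x. (g x)(i := u x)) \<longlongrightarrow> p) F"
proof (rule tendsto_coordinatewise)
  show "((\<lambda>x. ((g x)(i := u x)) j) \<longlongrightarrow> p j) F" for j
    using assms by (cases "j = i") auto
qed

lemma eventually_fun_upd_mem:
  fixes U :: "('i \<Rightarrow> real) set"
  assumes "open U" "p \<in> U"
  shows "\<forall>\<^sub>F s in nhds (p i). p(i := s) \<in> U"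
proof -
  have "((\<lambda>s. p(i := s)) \<longlongrightarrow> p) (nhds (p i))"
    by (rule tendsto_fun_upd) (auto intro: filterlim_ident)
  then show ?thesis using assms topological_tendstoD by blast
qed

lemma continuous_on_tendsto:
  assumes "continuous_on U f" "open U" "p \<in> U" "(g \<longlongrightarrow> p) F"
  shows "((\<lambda>x. f (g x)) \<longlongrightarrow> f p) F"
  using assms by (auto intro: continuous_on_tendsto_compose topological_tendstoD)

section \<open>Functions with continuous first partial derivatives\<close>

text \<open>One derivative suffices for the coefficients of the fields below: they are built from
  smooth functions and their first partials and are then differentiated once.\<close>

definition C1_on :: "('i \<Rightarrow> real) set \<Rightarrow> (('i \<Rightarrow> real) \<Rightarrow> real) \<Rightarrow> bool" where
  "C1_on U f \<longleftrightarrow> continuous_on U f \<and> (\<forall>i. continuous_on U (partial i f)) \<and>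
     (\<forall>p\<in>U. \<forall>i. (\<lambda>s. f (p(i := s))) differentiable (at (p i)))"

lemma C_infinity_on_imp_C1_on: "C_infinity_on U f \<Longrightarrow> C1_on U f"
  unfolding C_infinity_on_def C1_on_def
proof (intro conjI allI ballI)
  assume *: "\<forall>is. continuous_on U (foldr partial is f) \<and>
           (\<forall>p\<in>U. \<forall>i. (\<lambda>s. foldr partial is f (p(i := s))) differentiable (at (p i)))"
  show "continuous_on U f" using *[rule_format, of "[]"] by simp
  show "continuous_on U (partial i f)" for i using *[rule_format, of "[i]"] by simp
  show "(\<lambda>s. f (p(i := s))) differentiable (at (p i))" if "p \<in> U" for p i
    using *[rule_format, of "[]"] that by simp
qed

lemma C_infinity_on_partial: "C_infinity_on U f \<Longrightarrow> C_infinity_on U (partial i f)"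
  unfolding C_infinity_on_def
proof
  fix "is"
  assume *: "\<forall>is. continuous_on U (foldr partial is f) \<and>
           (\<forall>p\<in>U. \<forall>i. (\<lambda>s. foldr partial is f (p(i := s))) differentiable (at (p i)))"
  show "continuous_on U (foldr partial is (partial i f)) \<and>
           (\<forall>p\<in>U. \<forall>j. (\<lambda>s. foldr partial is (partial i f) (p(j := s))) differentiable (at (p j)))"
    using *[rule_format, of "is @ [i]"] by simp
qed

lemma C1_on_has_partial:
  assumes "C1_on U f" "p \<in> U"
  shows "((\<lambda>s. f (p(i := s))) has_real_derivative partial i f p) (at (p i))"
  using assms unfolding C1_on_def partial_def by (simp add: DERIV_deriv_iff_real_differentiable)

lemma C1_on_has_partial_upd:
  assumes "C1_on U f" "p(i := x) \<in> U"
  shows "((\<lambda>s. f (p(i := s))) has_real_derivative partial i f (p(i := x))) (at x)"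
  using C1_on_has_partial[OF assms, of i] by simp

lemma partialI:
  assumes "((\<lambda>s. f (p(i := s))) has_real_derivative D) (at (p i))"
  shows "partial i f p = D"
  using assms unfolding partial_def by (rule DERIV_imp_deriv)

lemma partial_cong:
  assumes "open U" "p \<in> U" "\<And>q. q \<in> U \<Longrightarrow> f q = g q"
  shows "partial i f p = partial i g p"
proof -
  have "\<forall>\<^sub>F s in nhds (p i). f (p(i := s)) = g (p(i := s))"
    using eventually_fun_upd_mem[OF assms(1,2)] by eventually_elim (use assms(3) in blast)
  then show ?thesis unfolding partial_def by (intro deriv_cong_ev) auto
qed

lemma partial_const [simp]: "partial i (\<lambda>_. c) p = 0"
  by (rule partialI) simp

lemma partial_coord: "partial i (\<lambda>q. q j) p = (if i = j then 1 else 0)"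
  by (rule partialI) (auto intro!: derivative_eq_intros)

lemma partial_add:
  assumes "C1_on U f" "C1_on U g" "p \<in> U"
  shows "partial i (\<lambda>q. f q + g q) p = partial i f p + partial i g p"
  using assms by (intro partialI DERIV_add C1_on_has_partial)

lemma partial_mult:
  assumes "C1_on U f" "C1_on U g" "p \<in> U"
  shows "partial i (\<lambda>q. f q * g q) p = partial i f p * g p + f p * partial i g p"
  using DERIV_mult[OF C1_on_has_partial[OF assms(1,3), of i] C1_on_has_partial[OF assms(2,3), of i]]
  by (intro partialI) (simp add: mult.commute)

lemma partial_sum:
  assumes "\<And>c. c \<in> S \<Longrightarrow> C1_on U (f c)" "p \<in> U"
  shows "partial i (\<lambda>q. \<Sum>c\<in>S. f c q) p = (\<Sum>c\<in>S. partial i (f c) p)"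
  using assms by (intro partialI DERIV_sum C1_on_has_partial)

lemma C1_onI:
  assumes "continuous_on U f"
    and "\<And>p i. p \<in> U \<Longrightarrow> ((\<lambda>s. f (p(i := s))) has_real_derivative D i p) (at (p i))"
    and "\<And>i. continuous_on U (D i)"
  shows "C1_on U f"
proof -
  have "partial i f p = D i p" if "p \<in> U" for i p
    using assms(2)[OF that] by (rule partialI)
  then have "continuous_on U (partial i f)" for i
    using assms(3)[of i] by (simp cong: continuous_on_cong)
  then show ?thesis unfolding C1_on_def
    using assms(1,2) real_differentiable_def by blast
qed

lemma C1_on_const: "C1_on U (\<lambda>_. c)"
  by (rule C1_onI[where D = "\<lambda>_ _. 0"]) auto

lemma C1_on_coord: "C1_on U (\<lambda>q. q j)"
  by (rule C1_onI[where D = "\<lambda>i _. if i = j then 1 else 0"])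
    (auto intro!: derivative_eq_intros continuous_on_subset[OF continuous_on_product_coordinates])

lemma C1_on_add:
  assumes "C1_on U f" "C1_on U g"
  shows "C1_on U (\<lambda>q. f q + g q)"
  by (rule C1_onI[where D = "\<lambda>i q. partial i f q + partial i g q"])
    (use assms in \<open>auto intro!: continuous_intros DERIV_add C1_on_has_partial simp: C1_on_def\<close>)

lemma C1_on_diff:
  assumes "C1_on U f" "C1_on U g"
  shows "C1_on U (\<lambda>q. f q - g q)"
  by (rule C1_onI[where D = "\<lambda>i q. partial i f q - partial i g q"])
    (use assms in \<open>auto intro!: continuous_intros DERIV_diff C1_on_has_partial simp: C1_on_def\<close>)

lemma C1_on_mult:
  assumes "C1_on U f" "C1_on U g"
  shows "C1_on U (\<lambda>q. f q * g q)"
proof (rule C1_onI[where D = "\<lambda>i q. partial i f q * g q + partial i g q * f q"])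
  show "((\<lambda>s. f (p(i := s)) * g (p(i := s))) has_real_derivative
      partial i f p * g p + partial i g p * f p) (at (p i))" if "p \<in> U" for p i
    using DERIV_mult[OF C1_on_has_partial[OF assms(1) that, of i] C1_on_has_partial[OF assms(2) that, of i]]
    by simp
qed (use assms in \<open>auto intro!: continuous_intros simp: C1_on_def\<close>)

lemma C1_on_sum:
  assumes "\<And>c. c \<in> S \<Longrightarrow> C1_on U (f c)"
  shows "C1_on U (\<lambda>q. \<Sum>c\<in>S. f c q)"
  using assms
  by (induction S rule: infinite_finite_induct) (auto intro: C1_on_const C1_on_add)

lemmas C1_on_intros = C1_on_const C1_on_coord C1_on_add C1_on_diff C1_on_mult C1_on_sum

section \<open>Functions of prescribed coordinates\<close>

lemma depends_only_onD:
  "depends_only_on U S f \<Longrightarrow> p \<in> U \<Longrightarrow> q \<in> U \<Longrightarrow> (\<And>i. i \<in> S \<Longrightarrow> p i = q i) \<Longrightarrow> f p = f q"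
  unfolding depends_only_on_def by blast

lemma depends_only_onI:
  "(\<And>p q. p \<in> U \<Longrightarrow> q \<in> U \<Longrightarrow> \<forall>i\<in>S. p i = q i \<Longrightarrow> f p = f q) \<Longrightarrow> depends_only_on U S f"
  unfolding depends_only_on_def by blast

lemma depends_only_on_coord: "j \<in> S \<Longrightarrow> depends_only_on U S (\<lambda>q. q j)"
  by (simp add: depends_only_on_def)

lemma depends_only_on_const: "depends_only_on U S (\<lambda>_. c)"
  by (simp add: depends_only_on_def)

lemma depends_only_on_binary:
  assumes "depends_only_on U S f" "depends_only_on U S g"
  shows "depends_only_on U S (\<lambda>q. f q + g q)" "depends_only_on U S (\<lambda>q. f q - g q)"
    "depends_only_on U S (\<lambda>q. f q * g q)"
  by (rule depends_only_onI, rule arg_cong2[OF depends_only_onD[OF assms(1)] depends_only_onD[OF assms(2)]], simp_all)+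

lemma depends_only_on_sum:
  assumes "\<And>c. c \<in> T \<Longrightarrow> depends_only_on U S (f c)"
  shows "depends_only_on U S (\<lambda>q. \<Sum>c\<in>T. f c q)"
  by (rule depends_only_onI, rule sum.cong[OF refl], rule depends_only_onD[OF assms]) auto

lemma partial_outside_eq_0:
  assumes "open U" "depends_only_on U S f" "i \<notin> S" "p \<in> U"
  shows "partial i f p = 0"
proof (rule partialI)
  have "\<forall>\<^sub>F s in nhds (p i). f (p(i := s)) = f p"
    using eventually_fun_upd_mem[OF assms(1,4), of i]
    by eventually_elim (rule depends_only_onD[OF assms(2)], use assms(3,4) in auto)
  then show "((\<lambda>s. f (p(i := s))) has_real_derivative 0) (at (p i))"
    by (subst DERIV_cong_ev[OF refl _ refl]) auto
qed

text \<open>For \<open>i\<close> in \<open>S\<close> the sections through \<open>p\<close> and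
  \<open>q\<close> agree near the common value \<open>p i\<close>; for \<open>i\<close> outside
  \<open>S\<close> both partials vanish.\<close>

lemma depends_only_on_partial:
  assumes "open U" "depends_only_on U S f"
  shows "depends_only_on U S (partial i f)"
  unfolding depends_only_on_def
proof (intro ballI impI)
  fix p q assume pq: "p \<in> U" "q \<in> U" and eq: "\<forall>i\<in>S. p i = q i"
  show "partial i f p = partial i f q"
  proof (cases "i \<in> S")
    case True
    have "\<forall>\<^sub>F s in nhds (p i). p(i := s) \<in> U \<and> q(i := s) \<in> U"
      using eventually_fun_upd_mem[OF assms(1) pq(1), of i]
        eventually_fun_upd_mem[OF assms(1) pq(2), of i] True eq by (simp add: eventually_conj)
    then have "\<forall>\<^sub>F s in nhds (p i). f (p(i := s)) = f (q(i := s))"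
      by eventually_elim (rule depends_only_onD[OF assms(2)], use eq in auto)
    then show ?thesis unfolding partial_def using True eq by (intro deriv_cong_ev) auto
  next
    case False
    show ?thesis using pq by (simp add: partial_outside_eq_0[OF assms False])
  qed
qed

section \<open>Chain rule along a curve\<close>

lemma MVT_between:
  fixes f :: "real \<Rightarrow> real"
  assumes "\<And>x. \<bar>x - a\<bar> \<le> \<bar>b - a\<bar> \<Longrightarrow> (f has_real_derivative f' x) (at x)"
  obtains z where "\<bar>z - a\<bar> \<le> \<bar>b - a\<bar>" "f b - f a = (b - a) * f' z"
proof -
  consider "a = b" | "a < b" | "b < a" by linarith
  then show ?thesis
  proof cases
    case 1 then show ?thesis using that[of a] by simp
  next
    case 2
    then have "\<exists>z>a. z < b \<and> f b - f a = (b - a) * f' z"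
      by (intro MVT2) (auto intro: assms)
    then show ?thesis using that by force
  next
    case 3
    then have "\<exists>z>b. z < a \<and> f a - f b = (a - b) * f' z"
      by (intro MVT2) (auto intro: assms)
    then obtain z where "z > b" "z < a" "f a - f b = (a - b) * f' z" by blast
    then show ?thesis using that[of z] 3 by (simp add: algebra_simps)
  qed
qed

text \<open>Only the finitely many coordinates in \<open>S\<close> matter, so they are released one
  after another: each increment is governed by the mean value theorem, and continuity of the partial
  gives the limit.\<close>

lemma has_derivative_along_curve:
  fixes f :: "('i \<Rightarrow> real) \<Rightarrow> real"
  assumes U: "open U" "\<gamma> t0 \<in> U" and f: "C1_on U f"
    and S: "depends_only_on U S f" "finite S"
    and \<gamma>: "\<And>i. ((\<lambda>t. \<gamma> t i) has_real_derivative v i) (at t0)"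
  shows "((\<lambda>t. f (\<gamma> t)) has_real_derivative (\<Sum>i\<in>S. v i * partial i f (\<gamma> t0))) (at t0)"
proof -
  define p where "p = \<gamma> t0"
  have pU: "p \<in> U" using U(2) by (simp add: p_def)
  have cont: "continuous_on U (partial i f)" for i using f by (simp add: C1_on_def)
  \<comment> \<open>Interpolates between the constant point \<open>p\<close> (empty set) and a point
    that \<open>f\<close> cannot tell from \<open>\<gamma> t\<close> (the set
    \<open>S\<close>).\<close>
  define m where "m S t = (\<lambda>i. if i \<in> S then \<gamma> t i else p i)" for S t
  obtain T e where T: "finite T" "e > 0" "\<And>q. (\<And>i. i \<in> T \<Longrightarrow> \<bar>q i - p i\<bar> < e) \<Longrightarrow> q \<in> U"
    using open_contains_box[OF U(1)] U(2) p_def by metis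
  have lim: "((\<lambda>t. \<gamma> t i) \<longlongrightarrow> p i) (nhds t0)" for i
    using DERIV_isCont[OF \<gamma>[of i]] unfolding p_def
    by (simp add: isCont_def tendsto_at_iff_tendsto_nhds[of "\<lambda>t. \<gamma> t i" t0])
  have near: "\<forall>\<^sub>F t in nhds t0. \<forall>i\<in>T. \<bar>\<gamma> t i - p i\<bar> < e"
    using lim T(1,2) by (intro eventually_ball_finite) (auto simp: tendsto_iff dist_real_def)
  have mU: "m R t \<in> U" if "\<forall>i\<in>T. \<bar>\<gamma> t i - p i\<bar> < e" for R t
    using that T(2) by (intro T(3)) (auto simp: m_def)
  have "((\<lambda>t. f (m R t)) has_real_derivative (\<Sum>i\<in>R. v i * partial i f p)) (at t0)"
    if "finite R" for R
    using that
  proof (induction R)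
    case empty
    then show ?case by (simp add: m_def)
  next
    case (insert i R)
    define E where "E t = f (m (insert i R) t) - f (m R t)" for t
    have upd: "m (insert i R) t = (m R t)(i := \<gamma> t i)" "m R t = (m R t)(i := p i)" for t
      using insert.hyps by (auto simp: m_def fun_eq_iff)
    have "\<exists>z. \<bar>z - p i\<bar> \<le> \<bar>\<gamma> t i - p i\<bar> \<and>
        E t = (\<gamma> t i - p i) * partial i f ((m R t)(i := z))"
      if t: "\<forall>i\<in>T. \<bar>\<gamma> t i - p i\<bar> < e" for t
    proof -
      have "((\<lambda>s. f ((m R t)(i := s))) has_real_derivative
          partial i f ((m R t)(i := x))) (at x)" if "\<bar>x - p i\<bar> \<le> \<bar>\<gamma> t i - p i\<bar>" for x
      proof (rule C1_on_has_partial_upd[OF f], rule T(3))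
        show "\<bar>((m R t)(i := x)) j - p j\<bar> < e" if "j \<in> T" for j
          using t that \<open>\<bar>x - p i\<bar> \<le> _\<close> T(2) by (force simp: m_def)
      qed
      from MVT_between[OF this] show ?thesis
        unfolding E_def using upd by metis
    qed
    then obtain \<zeta> where \<zeta>: "\<And>t. \<forall>i\<in>T. \<bar>\<gamma> t i - p i\<bar> < e \<Longrightarrow> \<bar>\<zeta> t - p i\<bar> \<le> \<bar>\<gamma> t i - p i\<bar>"
        "\<And>t. \<forall>i\<in>T. \<bar>\<gamma> t i - p i\<bar> < e \<Longrightarrow> E t = (\<gamma> t i - p i) * partial i f ((m R t)(i := \<zeta> t))"
      by metis
    \<comment> \<open>The intermediate values are squeezed to \<open>p i\<close>, so the points at
      which the partial is taken tend to \<open>p\<close>.\<close>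
    have "((\<lambda>t. \<zeta> t - p i) \<longlongrightarrow> 0) (nhds t0)"
    proof (rule Lim_null_comparison)
      show "\<forall>\<^sub>F t in nhds t0. norm (\<zeta> t - p i) \<le> \<bar>\<gamma> t i - p i\<bar>"
        using near by eventually_elim (use \<zeta>(1) in simp)
      show "((\<lambda>t. \<bar>\<gamma> t i - p i\<bar>) \<longlongrightarrow> 0) (nhds t0)"
        using lim[of i] by (simp add: LIM_zero_iff tendsto_rabs_zero_iff)
    qed
    then have "(\<zeta> \<longlongrightarrow> p i) (nhds t0)" by (simp add: LIM_zero_iff)
    moreover have "((\<lambda>t. m R t j) \<longlongrightarrow> p j) (nhds t0)" for j
      using lim by (cases "j \<in> R") (auto simp: m_def)
    ultimately have "((\<lambda>t. (m R t)(i := \<zeta> t)) \<longlongrightarrow> p) (nhds t0)"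
      by (intro tendsto_fun_upd)
    then have "((\<lambda>t. partial i f ((m R t)(i := \<zeta> t))) \<longlongrightarrow> partial i f p) (nhds t0)"
      by (rule continuous_on_tendsto[OF cont U(1) pU])
    then have "((\<lambda>t. partial i f ((m R t)(i := \<zeta> t))) \<longlongrightarrow> partial i f p) (at t0)"
      unfolding at_within_def by (rule tendsto_mono[OF inf_le1])
    moreover have "((\<lambda>t. (\<gamma> t i - p i) / (t - t0)) \<longlongrightarrow> v i) (at t0)"
      using \<gamma>[of i] unfolding has_field_derivative_iff p_def by simp
    ultimately have lim2: "((\<lambda>t. (\<gamma> t i - p i) / (t - t0) * partial i f ((m R t)(i := \<zeta> t)))
        \<longlongrightarrow> v i * partial i f p) (at t0)"
      by (intro tendsto_mult)
    have "((\<lambda>t. (E t - E t0) / (t - t0)) \<longlongrightarrow> v i * partial i f p) (at t0)"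
    proof (rule Lim_transform_eventually[OF lim2])
      have "m Q t0 = p" for Q by (simp add: m_def p_def fun_eq_iff)
      then have "E t0 = 0" by (simp add: E_def)
      moreover have "\<forall>\<^sub>F t in at t0. \<forall>i\<in>T. \<bar>\<gamma> t i - p i\<bar> < e"
        using near eventually_nhds_conv_at by blast
      ultimately show "\<forall>\<^sub>F t in at t0. (\<gamma> t i - p i) / (t - t0) * partial i f ((m R t)(i := \<zeta> t))
          = (E t - E t0) / (t - t0)"
        by (auto elim!: eventually_mono simp: \<zeta>(2))
    qed
    then have "(E has_real_derivative v i * partial i f p) (at t0)"
      by (simp add: has_field_derivative_iff)
    from DERIV_add[OF this insert.IH] show ?case
      unfolding E_def using insert.hyps by simp
  qed
  \<comment> \<open>Near \<open>t0\<close> the curve and \<open>m S t\<close> agree in all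
    coordinates on which \<open>f\<close> depends.\<close>
  from this[OF S(2)] show ?thesis
  proof (subst DERIV_cong_ev[OF refl _ refl])
    show "\<forall>\<^sub>F t in nhds t0. f (\<gamma> t) = f (m S t)"
      using near
    proof eventually_elim
      case (elim t)
      then have "\<gamma> t \<in> U" by (intro T(3)) auto
      moreover have "\<forall>i\<in>S. \<gamma> t i = m S t i" by (simp add: m_def)
      ultimately show ?case using S(1) mU[OF elim, of S] unfolding depends_only_on_def by blast
    qed
  qed (simp add: p_def)
qed

section \<open>Symmetry of second partials and commutators of fields\<close>

text \<open>Mean value theorem twice: in \<open>i\<close> for the increment of \<open>f\<close> in
  direction \<open>j\<close>, then in \<open>j\<close> for \<open>partial i f\<close>.\<close>

lemma second_difference_eq_partial:
  assumes f: "C1_on U f" "C1_on U (partial i f)" and ij: "i \<noteq> j" and h: "h > 0"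
    and box: "\<And>s t. \<bar>s - p i\<bar> \<le> h \<Longrightarrow> \<bar>t - p j\<bar> \<le> h \<Longrightarrow> p(i := s, j := t) \<in> U"
  obtains s t where "\<bar>s - p i\<bar> \<le> h" "\<bar>t - p j\<bar> \<le> h"
    "f (p(i := p i + h, j := p j + h)) - f (p(i := p i + h))
       - f (p(j := p j + h)) + f p = h * h * partial j (partial i f) (p(i := s, j := t))"
proof -
  define g where "g s = f (p(i := s, j := p j + h)) - f (p(i := s, j := p j))" for s
  have "(g has_real_derivative
      partial i f (p(i := x, j := p j + h)) - partial i f (p(i := x, j := p j))) (at x)"
    if "\<bar>x - p i\<bar> \<le> \<bar>p i + h - p i\<bar>" for x
  proof -
    have "p(j := t, i := x) \<in> U" if "\<bar>t - p j\<bar> \<le> h" for t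
      using box[of x t] that \<open>\<bar>x - p i\<bar> \<le> _\<close> h by (simp add: fun_upd_twist[OF ij])
    from this[of "p j"] this[of "p j + h"] show ?thesis
      unfolding g_def fun_upd_twist[OF ij] using h
      by (intro DERIV_diff C1_on_has_partial_upd[OF f(1)]) simp_all
  qed
  then obtain s where s: "\<bar>s - p i\<bar> \<le> h" "g (p i + h) - g (p i) =
      h * (partial i f (p(i := s, j := p j + h)) - partial i f (p(i := s, j := p j)))"
    using h by (elim MVT_between) auto
  have "((\<lambda>t. partial i f (p(i := s, j := t))) has_real_derivative
      partial j (partial i f) (p(i := s, j := x))) (at x)"
    if "\<bar>x - p j\<bar> \<le> \<bar>p j + h - p j\<bar>" for x
    using s(1) that box h by (intro C1_on_has_partial_upd[OF f(2)]) auto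
  then obtain t where t: "\<bar>t - p j\<bar> \<le> h"
      "partial i f (p(i := s, j := p j + h)) - partial i f (p(i := s, j := p j)) =
       h * partial j (partial i f) (p(i := s, j := t))"
    using h by (elim MVT_between) auto
  have "p(i := s, j := p j) = p(i := s)" for s using ij by auto
  then have "f (p(i := p i + h, j := p j + h)) - f (p(i := p i + h))
       - f (p(j := p j + h)) + f p = g (p i + h) - g (p i)"
    unfolding g_def by simp
  then show ?thesis using that s t by (simp add: mult.assoc)
qed

text \<open>The second difference is symmetric in the two directions, so at every small scale
  \<open>h\<close> the mixed partials agree at two points whose coordinates are within
  \<open>h\<close> of those of \<open>p\<close>; continuity lets \<open>h\<close> tend to 0.\<close>

lemma partial_commute:
  assumes U: "open U" "p \<in> U"
    and f: "C1_on U f" "C1_on U (partial i f)" "C1_on U (partial j f)"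
  shows "partial i (partial j f) p = partial j (partial i f) p"
proof (cases "i = j")
  case ij: False
  obtain T e where T: "finite T" "e > 0" "\<And>q. (\<And>i. i \<in> T \<Longrightarrow> \<bar>q i - p i\<bar> < e) \<Longrightarrow> q \<in> U"
    using open_contains_box[OF U] by metis
  have box: "p(i := s, j := t) \<in> U" "p(j := t, i := s) \<in> U"
    if "\<bar>s - p i\<bar> \<le> h" "\<bar>t - p j\<bar> \<le> h" "h < e" for s t h
    using that T(2) by (auto intro!: T(3))
  have "\<exists>s t s' t'. \<bar>s - p i\<bar> \<le> h \<and> \<bar>t - p j\<bar> \<le> h \<and> \<bar>s' - p i\<bar> \<le> h \<and> \<bar>t' - p j\<bar> \<le> h \<and>
      partial j (partial i f) (p(i := s, j := t)) = partial i (partial j f) (p(i := s', j := t'))"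
    if h: "0 < h" "h < e" for h
  proof -
    obtain s t where st: "\<bar>s - p i\<bar> \<le> h" "\<bar>t - p j\<bar> \<le> h"
      "f (p(i := p i + h, j := p j + h)) - f (p(i := p i + h))
       - f (p(j := p j + h)) + f p = h * h * partial j (partial i f) (p(i := s, j := t))"
      using second_difference_eq_partial[OF f(1,2) ij h(1), of p] box h(2) by blast
    obtain t' s' where st': "\<bar>t' - p j\<bar> \<le> h" "\<bar>s' - p i\<bar> \<le> h"
      "f (p(j := p j + h, i := p i + h)) - f (p(j := p j + h))
       - f (p(i := p i + h)) + f p = h * h * partial i (partial j f) (p(j := t', i := s'))"
      using second_difference_eq_partial[OF f(1,3) ij[symmetric] h(1), of p] box h(2) by blast
    have "h * h * partial j (partial i f) (p(i := s, j := t)) =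
        h * h * partial i (partial j f) (p(i := s', j := t'))"
      using st(3) st'(3) unfolding fun_upd_twist[OF ij] by linarith
    then show ?thesis using st(1,2) st'(1,2) h(1) by auto
  qed
  then obtain s t s' t' where st: "\<And>h. 0 < h \<Longrightarrow> h < e \<Longrightarrow> \<bar>s h - p i\<bar> \<le> h \<and> \<bar>t h - p j\<bar> \<le> h \<and>
      \<bar>s' h - p i\<bar> \<le> h \<and> \<bar>t' h - p j\<bar> \<le> h \<and> partial j (partial i f) (p(i := s h, j := t h)) =
      partial i (partial j f) (p(i := s' h, j := t' h))"
    by metis
  have small: "\<forall>\<^sub>F h in at_right 0. 0 < h \<and> h < e"
    using T(2) by (auto simp: eventually_at_right)
  have lim: "(u \<longlongrightarrow> a) (at_right 0)" if "\<And>h. 0 < h \<Longrightarrow> h < e \<Longrightarrow> \<bar>u h - a\<bar> \<le> h" for u :: "real \<Rightarrow> real" and a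
  proof -
    have "((\<lambda>h. u h - a) \<longlongrightarrow> 0) (at_right 0)"
      by (rule Lim_null_comparison[of _ "\<lambda>h. h"])
        (use small that in \<open>auto elim!: eventually_mono simp: tendsto_ident_at\<close>)
    then show ?thesis by (simp add: LIM_zero_iff)
  qed
  have lim2: "((\<lambda>h. g (p(i := u h, j := w h))) \<longlongrightarrow> g p) (at_right 0)"
    if "(u \<longlongrightarrow> p i) (at_right 0)" "(w \<longlongrightarrow> p j) (at_right 0)" "continuous_on U g"
    for u w :: "real \<Rightarrow> real" and g
  proof (rule continuous_on_tendsto[OF that(3) U])
    show "((\<lambda>h. p(i := u h, j := w h)) \<longlongrightarrow> p) (at_right 0)"
    proof (rule tendsto_fun_upd)
      show "((\<lambda>h. (p(i := u h)) k) \<longlongrightarrow> p k) (at_right 0)" for k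
        using that(1) by (cases "k = i") auto
    qed (rule that(2))
  qed
  have "((\<lambda>h. partial i (partial j f) (p(i := s' h, j := t' h))) \<longlongrightarrow> partial i (partial j f) p) (at_right 0)"
    using st f(3) by (intro lim2 lim) (auto simp: C1_on_def)
  moreover have "((\<lambda>h. partial j (partial i f) (p(i := s h, j := t h))) \<longlongrightarrow> partial j (partial i f) p) (at_right 0)"
    using st f(2) by (intro lim2 lim) (auto simp: C1_on_def)
  then have "((\<lambda>h. partial i (partial j f) (p(i := s' h, j := t' h))) \<longlongrightarrow> partial j (partial i f) p) (at_right 0)"
    by (rule Lim_transform_eventually) (use small st in \<open>auto elim!: eventually_mono\<close>)
  ultimately show ?thesis by (rule tendsto_unique[rotated]) simp
qed simp

lemma partial_directional:
  assumes "p \<in> U" "\<And>c. c \<in> S \<Longrightarrow> C1_on U (a c)" "\<And>c. c \<in> S \<Longrightarrow> C1_on U (partial c f)"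
  shows "partial i (\<lambda>q. \<Sum>c\<in>S. a c q * partial c f q) p =
    (\<Sum>c\<in>S. partial i (a c) p * partial c f p + a c p * partial i (partial c f) p)"
  using assms by (simp add: partial_sum[of S U] partial_mult[of U] C1_on_mult)

text \<open>By symmetry of the second partials the second order terms cancel; what is left comes
  from each field acting on the coefficients of the other.\<close>

lemma commutator_of_fields:
  assumes U: "open U" "p \<in> U"
    and f: "C1_on U f" "\<And>c. C1_on U (partial c f)"
    and a: "\<And>c. c \<in> S \<Longrightarrow> C1_on U (a c)" and b: "\<And>c. c \<in> S \<Longrightarrow> C1_on U (b c)"
  shows "(\<Sum>d\<in>S. a d p * partial d (\<lambda>q. \<Sum>c\<in>S. b c q * partial c f q) p)
       - (\<Sum>d\<in>S. b d p * partial d (\<lambda>q. \<Sum>c\<in>S. a c q * partial c f q) p)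
       = (\<Sum>c\<in>S. ((\<Sum>d\<in>S. a d p * partial d (b c) p) - (\<Sum>d\<in>S. b d p * partial d (a c) p)) * partial c f p)"
proof -
  have "(\<Sum>d\<in>S. \<Sum>c\<in>S. a d p * b c p * partial d (partial c f) p) =
      (\<Sum>c\<in>S. \<Sum>d\<in>S. a d p * b c p * partial d (partial c f) p)"
    by (rule sum.swap)
  also have "\<dots> = (\<Sum>d\<in>S. \<Sum>c\<in>S. b d p * a c p * partial d (partial c f) p)"
    using partial_commute[OF U f(1)] f(2) by (intro sum.cong refl) (metis mult.commute)
  finally have second: "(\<Sum>d\<in>S. \<Sum>c\<in>S. a d p * (b c p * partial d (partial c f) p)) =
      (\<Sum>d\<in>S. \<Sum>c\<in>S. b d p * (a c p * partial d (partial c f) p))"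
    by (simp add: mult.assoc)
  have first: "(\<Sum>d\<in>S. \<Sum>c\<in>S. u d p * (partial d (w c) p * partial c f p)) =
      (\<Sum>c\<in>S. (\<Sum>d\<in>S. u d p * partial d (w c) p) * partial c f p)" for u w
    by (subst sum.swap) (simp add: sum_distrib_right mult.assoc)
  show ?thesis
    using U(2) a b f(2)
    by (simp add: partial_directional[of p U S] sum_distrib_left distrib_left sum.distrib
        second first left_diff_distrib sum_subtractf)
qed


subsection \<open>Fields of first order type\<close>

lemma low_coords_eq: "- higher_coords = insert X (range (\<lambda>K. Y K 0) \<union> range (\<lambda>K. Y K 1))"
proof (rule set_eqI)
  show "c \<in> - higher_coords \<longleftrightarrow> c \<in> insert X (range (\<lambda>K. Y K 0) \<union> range (\<lambda>K. Y K 1))" for c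
    by (cases c) (auto simp: higher_coords_def image_iff)
qed

lemma finite_low_coords: "finite (- higher_coords)"
  unfolding low_coords_eq by simp

lemma low_coords_memI: "X \<in> - higher_coords" "Y L 0 \<in> - higher_coords" "Y L 1 \<in> - higher_coords"
  unfolding low_coords_eq by auto

lemma sum_low_coords:
  fixes f :: "coord \<Rightarrow> real"
  shows "sum f (- higher_coords) = f X + (\<Sum>K\<in>UNIV. f (Y K 0)) + (\<Sum>K\<in>UNIV. f (Y K 1))"
proof -
  have "sum f (range (\<lambda>K. Y K a)) = (\<Sum>K\<in>UNIV. f (Y K a))" for a
    by (subst sum.reindex) (auto simp: inj_on_def)
  moreover have "range (\<lambda>K. Y K 0) \<inter> range (\<lambda>K. Y K 1) = {}" by auto
  moreover have "X \<notin> range (\<lambda>K. Y K 0) \<union> range (\<lambda>K. Y K 1)" by auto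
  ultimately show ?thesis
    unfolding low_coords_eq by (simp add: sum.union_disjoint del: One_nat_def)
qed

text \<open>The derivation with coefficients \<open>a\<close>, cut off to a finite sum. It is meant
  for functions of the coordinates of order at most one, whose other partials vanish.\<close>

definition apply_field :: "(coord \<Rightarrow> jet \<Rightarrow> real) \<Rightarrow> (jet \<Rightarrow> real) \<Rightarrow> jet \<Rightarrow> real" where
  "apply_field a h p = (\<Sum>c\<in>- higher_coords. a c p * partial c h p)"

fun field_coeff :: "(jet \<Rightarrow> real) \<Rightarrow> (2 \<Rightarrow> nat \<Rightarrow> jet \<Rightarrow> real) \<Rightarrow> coord \<Rightarrow> jet \<Rightarrow> real" where
  "field_coeff \<xi> \<eta> X = \<xi>"
| "field_coeff \<xi> \<eta> (Y L a) = \<eta> L a"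

text \<open>On functions of the coordinates of order at most one, the given field acts as the field with
  coefficients \<open>base_coeff\<close> plus the sum over \<open>R\<close> of \<open>Y R 2\<close> times the field with coefficients
  \<open>vertical_coeff R\<close>. The values of both at orders above one are irrelevant.\<close>

fun base_coeff :: "(jet \<Rightarrow> real) \<Rightarrow> (2 \<Rightarrow> nat \<Rightarrow> jet \<Rightarrow> real) \<Rightarrow> coord \<Rightarrow> jet \<Rightarrow> real" where
  "base_coeff \<xi> \<eta> X = \<xi>"
| "base_coeff \<xi> \<eta> (Y L a) = (if a = 0 then \<eta> L 0 else
     (\<lambda>p. coefO \<xi> \<eta> L p + (\<Sum>J\<in>UNIV. p (Y J 1) * coefN \<xi> \<eta> J L p)))"

fun vertical_coeff ::
  "(jet \<Rightarrow> real) \<Rightarrow> (2 \<Rightarrow> nat \<Rightarrow> jet \<Rightarrow> real) \<Rightarrow> 2 \<Rightarrow> coord \<Rightarrow> jet \<Rightarrow> real" where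
  "vertical_coeff \<xi> \<eta> R X = (\<lambda>_. 0)"
| "vertical_coeff \<xi> \<eta> R (Y L a) = (if a = 0 then (\<lambda>_. 0) else coefM \<xi> \<eta> R L)"

lemma apply_vertical:
  "apply_field (vertical_coeff \<xi> \<eta> R) h p = (\<Sum>P\<in>UNIV. coefM \<xi> \<eta> R P p * partial (Y P 1) h p)"
  by (simp add: apply_field_def sum_low_coords)

text \<open>Partials along coordinates of order two or more vanish, so second derivatives are the
  highest that occur, and they enter linearly.\<close>

lemma total_deriv_low:
  assumes "open U" "depends_only_on U (- higher_coords) f" "p \<in> U"
  shows "total_deriv f p = partial X f p + (\<Sum>L\<in>UNIV. p (Y L 1) * partial (Y L 0) f p)
    + (\<Sum>L\<in>UNIV. p (Y L 2) * partial (Y L 1) f p)"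
proof -
  have zero: "partial (Y L a) f p = 0" if "a \<ge> 2" for L a
    using that by (intro partial_outside_eq_0[OF assms(1,2) _ assms(3)]) (auto simp: higher_coords_def)
  have "a = 0 \<or> a = 1" if "partial (Y L a) f p \<noteq> 0" for L a
  proof -
    have "a < 2" using that zero not_le by blast
    then show ?thesis by auto
  qed
  then have sub: "{(L, a). partial (Y L a) f p \<noteq> 0} \<subseteq> UNIV \<times> {0, 1}"
    by blast
  have "(\<Sum>(L, a) | partial (Y L a) f p \<noteq> 0. p (Y L (Suc a)) * partial (Y L a) f p)
    = (\<Sum>(L, a)\<in>UNIV \<times> {0, 1}. p (Y L (Suc a)) * partial (Y L a) f p)"
    by (rule sum.mono_neutral_left) (use sub in auto)
  also have "\<dots> = (\<Sum>L\<in>UNIV. p (Y L 1) * partial (Y L 0) f p + p (Y L 2) * partial (Y L 1) f p)"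
    by (simp add: sum.cartesian_product[symmetric] numeral_2_eq_2)
  finally show ?thesis by (simp add: total_deriv_def sum.distrib)
qed

section \<open>Splitting the field by second derivatives\<close>

locale low_order_field =
  fixes U :: "jet set" and \<xi> :: "jet \<Rightarrow> real" and \<eta> :: "2 \<Rightarrow> nat \<Rightarrow> jet \<Rightarrow> real"
  assumes U: "open U"
    and field: "Lie_Baecklund_on U \<xi> \<eta>"
    and dep_\<xi>: "depends_only_on U (- higher_coords) \<xi>"
    and dep_\<eta>: "depends_only_on U (- higher_coords) (\<eta> L 0)"
begin

abbreviation "O' \<equiv> coefO \<xi> \<eta>"
abbreviation "N \<equiv> coefN \<xi> \<eta>"
abbreviation "M \<equiv> coefM \<xi> \<eta>"
abbreviation "full \<equiv> field_coeff \<xi> \<eta>"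
abbreviation "base \<equiv> base_coeff \<xi> \<eta>"
abbreviation "vert \<equiv> vertical_coeff \<xi> \<eta>"

lemma smooth: "C_infinity_on U \<xi>" "C_infinity_on U (\<eta> L k)"
  using field unfolding Lie_Baecklund_on_def vector_field_on_def smooth_fun_on_def by auto

lemmas C1_partial = smooth[THEN C_infinity_on_partial, THEN C_infinity_on_imp_C1_on]
lemmas dep_partial = depends_only_on_partial[OF U dep_\<xi>] depends_only_on_partial[OF U dep_\<eta>]
lemmas dep_intros = dep_\<xi> dep_\<eta> dep_partial depends_only_on_binary depends_only_on_sum
  depends_only_on_const depends_only_on_coord[OF low_coords_memI(1)]
  depends_only_on_coord[OF low_coords_memI(2)] depends_only_on_coord[OF low_coords_memI(3)]

lemma C1_coef: "C1_on U (O' L)" "C1_on U (N K L)" "C1_on U (M K L)"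
  unfolding coefO_def[abs_def] coefN_def[abs_def] coefM_def[abs_def]
  by (intro C1_on_intros C1_partial)+

lemma dep_coef:
  "depends_only_on U (- higher_coords) (O' L)" "depends_only_on U (- higher_coords) (N K L)"
  "depends_only_on U (- higher_coords) (M K L)"
  unfolding coefO_def[abs_def] coefN_def[abs_def] coefM_def[abs_def]
  by (intro dep_intros)+

lemma C1_base: "C1_on U (base c)"
  by (cases c) (auto intro!: C1_on_intros C1_coef simp: smooth[THEN C_infinity_on_imp_C1_on])

lemma dep_base: "depends_only_on U (- higher_coords) (base c)"
  by (cases c) (auto intro!: dep_intros dep_coef simp del: One_nat_def)

lemma C1_vert: "C1_on U (vert R c)"
  by (cases c) (auto intro!: C1_on_intros C1_coef)

lemma dep_vert: "depends_only_on U (- higher_coords) (vert R c)"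
  by (cases c) (auto intro!: dep_intros dep_coef)

lemma C1_apply_base:
  assumes "\<And>c. C1_on U (partial c h)"
  shows "C1_on U (apply_field base h)"
  unfolding apply_field_def[abs_def] by (intro C1_on_intros C1_base assms)

lemma dep_apply:
  assumes "\<And>c. depends_only_on U (- higher_coords) (b c)" "depends_only_on U (- higher_coords) h"
  shows "depends_only_on U (- higher_coords) (apply_field b h)"
  unfolding apply_field_def[abs_def]
  by (intro dep_intros depends_only_on_partial[OF U] assms)

text \<open>Prolongation formula with the total derivatives expanded and the terms collected by
  second derivatives; this is where \<open>O'\<close>, \<open>N\<close> and \<open>M\<close> come
  from.\<close>

lemma eta_1:
  assumes "p \<in> U"
  shows "\<eta> P 1 p = O' P p + (\<Sum>J\<in>UNIV. p (Y J 1) * N J P p) + (\<Sum>R\<in>UNIV. p (Y R 2) * M R P p)"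
proof -
  have "\<eta> P 1 p = total_deriv (\<eta> P 0) p - p (Y P 1) * total_deriv \<xi> p"
    using field assms unfolding Lie_Baecklund_on_def by (metis One_nat_def)
  then show ?thesis
    unfolding total_deriv_low[OF U dep_\<xi> assms] total_deriv_low[OF U dep_\<eta> assms]
      coefO_def coefN_def coefM_def
    by (simp add: sum_2 algebra_simps)
qed

text \<open>Along \<open>X\<close> and \<open>Y L 0\<close> the coefficients \<open>full\<close> and
  \<open>base\<close> coincide and \<open>vert R\<close> vanishes; along \<open>Y L 1\<close> the
  splitting is \<open>eta_1\<close>.\<close>

lemma apply_field_split:
  assumes "p \<in> U"
  shows "apply_field full h p = apply_field base h p + (\<Sum>R\<in>UNIV. p (Y R 2) * apply_field (vert R) h p)"
  using eta_1[OF assms] unfolding apply_vertical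
  by (simp add: apply_field_def sum_low_coords sum_2 algebra_simps)

text \<open>Identifies \<open>coefQ\<close> as a \<open>Y P 1\<close> component of the commutator of
  \<open>base\<close> with \<open>vert R\<close>: its first three terms are \<open>base\<close>
  acting on \<open>M R P\<close>, the subtracted bracket is \<open>vert R\<close> acting on
  \<open>base (Y P 1)\<close>.\<close>

lemma coefQ_eq:
  assumes "p \<in> U"
  shows "coefQ \<xi> \<eta> R P p = apply_field base (M R P) p - apply_field (vert R) (base (Y P 1)) p"
proof -
  \<comment> \<open>The Kronecker delta comes from differentiating the factor
    \<open>q (Y J 1)\<close>; it produces the products of \<open>M\<close> and \<open>N\<close> in
    \<open>coefQ\<close>.\<close>
  have "partial (Y S 1) (base (Y P 1)) p = partial (Y S 1) (O' P) p
      + (\<Sum>J\<in>UNIV. (if S = J then 1 else 0) * N J P p + p (Y J 1) * partial (Y S 1) (N J P) p)" for S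
  proof -
    have "C1_on U (\<lambda>q. q (Y J 1) * N J P q)" for J by (intro C1_on_intros C1_coef)
    then show ?thesis
      using assms
      by (simp add: partial_add[where U = U] partial_sum[where U = U] partial_mult[where U = U]
          C1_on_intros C1_coef partial_coord)
  qed
  then show ?thesis
    unfolding coefQ_def apply_vertical
    by (simp add: apply_field_def sum_low_coords sum_2 algebra_simps)
qed

text \<open>By the splitting, \<open>apply_field full h\<close> changes with \<open>Y R 2\<close> at
  the constant rate \<open>apply_field (vert R) h\<close>; equal values at two different arguments
  force this rate to be 0.\<close>

lemma vertical_eq_0:
  assumes h: "depends_only_on U (- higher_coords) h"
    and p: "p \<in> U" "p(Y R 2 := s) \<in> U" "s \<noteq> p (Y R 2)"
    and eq: "apply_field full h p = apply_field full h (p(Y R 2 := s))"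
  shows "apply_field (vert R) h p = 0"
proof -
  \<comment> \<open>Functions of the low coordinates do not see the change of \<open>Y R 2\<close>,
    so the terms of the splitting take the same values at both points.\<close>
  have same: "g (p(Y R 2 := s)) = g p" if "depends_only_on U (- higher_coords) g" for g
    by (rule depends_only_onD[OF that p(2,1)]) (auto simp: higher_coords_def)
  have "(\<Sum>S\<in>UNIV. p (Y S 2) * apply_field (vert S) h p)
      = (\<Sum>S\<in>UNIV. (p(Y R 2 := s)) (Y S 2) * apply_field (vert S) h p)"
    using eq apply_field_split[OF p(1), of h] apply_field_split[OF p(2), of h]
      same[OF dep_apply[OF dep_base h]] same[OF dep_apply[OF dep_vert h]] by simp
  then have "(\<Sum>S\<in>UNIV. ((p(Y R 2 := s)) (Y S 2) - p (Y S 2)) * apply_field (vert S) h p) = 0"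
    by (simp add: left_diff_distrib sum_subtractf)
  also have "(\<Sum>S\<in>UNIV. ((p(Y R 2 := s)) (Y S 2) - p (Y S 2)) * apply_field (vert S) h p)
      = (\<Sum>S\<in>UNIV. if S = R then (s - p (Y R 2)) * apply_field (vert R) h p else 0)"
    by (rule sum.cong) auto
  finally show ?thesis using p(3) by simp
qed

text \<open>Both compositions of \<open>base\<close> and \<open>vert R\<close> annihilate
  \<open>f\<close> at \<open>p\<close>, hence so does the commutator. Its components along
  \<open>X\<close> and \<open>Y L 0\<close> vanish by the hypotheses on \<xi> and \<eta>, and
  \<open>coefQ\<close> remains.\<close>

lemma sum_coefQ_eq_0:
  assumes "p \<in> U"
    and f: "C1_on U f" "\<And>c. C1_on U (partial c f)"
    and vert: "\<And>q. q \<in> U \<Longrightarrow> apply_field (vert R) f q = 0"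
      "apply_field (vert R) \<xi> p = 0" "\<And>L. apply_field (vert R) (\<eta> L 0) p = 0"
    and "apply_field (vert R) (apply_field base f) p = 0"
  shows "(\<Sum>P\<in>UNIV. coefQ \<xi> \<eta> R P p * partial (Y P 1) f p) = 0"
proof -
  \<comment> \<open>Differentiation uses the vanishing on all of the open set \<open>U\<close>, not
    just at \<open>p\<close>.\<close>
  have "partial d (apply_field (vert R) f) p = 0" for d
    using partial_cong[OF U assms(1), of "apply_field (vert R) f" "\<lambda>_. 0"] vert(1) by simp
  then have "apply_field base (apply_field (vert R) f) p = 0" by (simp add: apply_field_def[of base])
  then have "(\<Sum>c\<in>- higher_coords. (apply_field (vert R) (base c) p - apply_field base (vert R c) p)
      * partial c f p) = 0"
    using commutator_of_fields[where a = "vert R" and b = base and S = "- higher_coords",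
        OF U assms(1) f C1_vert C1_base] assms(7)
    unfolding apply_field_def[abs_def] by simp
  moreover have "apply_field base (\<lambda>_. 0) p = 0" by (simp add: apply_field_def)
  ultimately have "(\<Sum>P\<in>UNIV. (apply_field (vert R) (base (Y P 1)) p - apply_field base (M R P) p)
      * partial (Y P 1) f p) = 0"
    unfolding sum_low_coords using vert(2,3) by simp
  \<comment> \<open>The commutator was taken with \<open>vert R\<close> first and
    \<open>base\<close> second, hence the sign.\<close>
  then have "(\<Sum>P\<in>UNIV. - (coefQ \<xi> \<eta> R P p * partial (Y P 1) f p)) = 0"
    unfolding coefQ_eq[OF assms(1)] by (simp only: minus_mult_left minus_diff_eq)
  then show ?thesis by (simp add: sum_negf)
qed

end

subsection \<open>Flows\<close>

locale low_order_flow = low_order_field +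
  fixes W :: "(jet \<times> real) set" and \<Phi> :: "real \<Rightarrow> jet \<Rightarrow> jet"
  assumes flow: "exponentiable_to U \<xi> \<eta> W \<Phi>"
    and dep_\<Xi>: "depends_only_on {p. (p, t) \<in> W} (- higher_coords) (\<lambda>p. \<Phi> t p X)"
    and dep_H: "depends_only_on {p. (p, t) \<in> W} (- higher_coords) (\<lambda>p. \<Phi> t p (Y L 0))"
begin

lemma flow_0: "p \<in> U \<Longrightarrow> \<Phi> 0 p = p"
  using flow unfolding exponentiable_to_def by blast

lemma eventually_mem_W:
  assumes "(p, t) \<in> W"
  shows "\<forall>\<^sub>F s in nhds t. (p, s) \<in> W"
proof -
  have "((\<lambda>s. (p, s)) \<longlongrightarrow> (p, t)) (nhds t)"
    by (intro tendsto_Pair tendsto_const filterlim_ident)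
  then show ?thesis
    using flow assms topological_tendstoD unfolding exponentiable_to_def by blast
qed

text \<open>The orbit starts in the open set \<open>U\<close> and is continuous in time because each
  of its components is.\<close>

lemma eventually_flow_mem:
  assumes "p \<in> U"
  shows "\<forall>\<^sub>F t in nhds 0. (p, t) \<in> W \<and> \<Phi> t p \<in> U"
proof -
  have W: "open W" "(p, 0) \<in> W" using flow assms unfolding exponentiable_to_def by auto
  define T where "T = {t. (p, t) \<in> W}"
  have T: "open T" "0 \<in> T"
  proof -
    have "T = Pair p -` W" by (auto simp: T_def)
    then show "open T" using W(1) by (auto intro!: open_vimage continuous_intros)
    show "0 \<in> T" using W by (simp add: T_def)
  qed
  \<comment> \<open>Places \<open>(p, t)\<close> in the option-indexed space on which joint
    smoothness of the flow is stated.\<close>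
  define q where "q t = case_option t p" for t :: real
  have "continuous_on T q"
  proof (rule continuous_on_coordinatewise_then_product)
    show "continuous_on T (\<lambda>t. q t i)" for i
      by (cases i) (auto simp: q_def)
  qed
  have qS: "q t \<circ> Some = p" "q t None = t" for t by (auto simp: q_def)
  have "continuous_on T (\<lambda>t. \<Phi> t p)"
  proof (rule continuous_on_coordinatewise_then_product)
    fix c
    have "continuous_on {q. (q \<circ> Some, q None) \<in> W} (\<lambda>q. \<Phi> (q None) (q \<circ> Some) c)"
      using flow C_infinity_on_imp_C1_on unfolding exponentiable_to_def C1_on_def by blast
    moreover have "q ` T \<subseteq> {q. (q \<circ> Some, q None) \<in> W}"
      by (auto simp: qS T_def)
    ultimately have "continuous_on T (\<lambda>t. \<Phi> (q t None) (q t \<circ> Some) c)"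
      using continuous_on_compose2 \<open>continuous_on T q\<close> by blast
    then show "continuous_on T (\<lambda>t. \<Phi> t p c)" by (simp only: qS)
  qed
  from continuous_on_tendsto[OF this T filterlim_ident]
  have "\<forall>\<^sub>F t in nhds 0. \<Phi> t p \<in> U"
    using U assms flow_0[OF assms] topological_tendstoD by fastforce
  then show ?thesis using eventually_mem_W[OF W(2)] eventually_conj by blast
qed

lemma flow_has_derivative_0:
  assumes "p \<in> U"
  shows "((\<lambda>t. \<Phi> t p c) has_real_derivative full c p) (at 0)"
  using flow assms unfolding exponentiable_to_def by (cases c) auto

text \<open>The composition law carries the derivative at time 0 to time \<open>t\<close>: near
  \<open>t\<close> the orbit of \<open>p\<close> is the orbit of \<open>\<Phi> t p\<close>, shifted
  in time.\<close>

lemma flow_has_derivative: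
  assumes "(p, t) \<in> W" "\<Phi> t p \<in> U"
  shows "((\<lambda>s. \<Phi> s p c) has_real_derivative full c (\<Phi> t p)) (at t)"
proof -
  have "(\<Phi> t p, 0) \<in> W" using flow assms(2) unfolding exponentiable_to_def by auto
  then have 1: "\<forall>\<^sub>F s in nhds 0. (\<Phi> t p, s) \<in> W" by (rule eventually_mem_W)
  have "((\<lambda>s. s + t) \<longlongrightarrow> t) (nhds 0)"
    using tendsto_add[OF filterlim_ident tendsto_const[of t], of 0] by simp
  then have 2: "\<forall>\<^sub>F s in nhds 0. (p, s + t) \<in> W"
    by (rule eventually_compose_filterlim[OF eventually_mem_W[OF assms(1)]])
  have "\<forall>\<^sub>F s in nhds 0. \<Phi> s (\<Phi> t p) c = \<Phi> (s + t) p c"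
    using 1 2 by eventually_elim (use flow assms(1) in \<open>simp add: exponentiable_to_def\<close>)
  from iffD1[OF DERIV_cong_ev[OF refl this refl] flow_has_derivative_0[OF assms(2)]]
  show ?thesis using DERIV_shift[of "\<lambda>s. \<Phi> s p c" _ 0 t] by simp
qed

text \<open>Differentiate the assumed equality in time by the chain rule. The result holds again for
  all small times, so the step can be repeated.\<close>

lemma apply_field_along_flow:
  assumes h: "C1_on U h" "depends_only_on U (- higher_coords) h" and p: "p \<in> U" "p' \<in> U"
    and eq: "\<forall>\<^sub>F t in nhds 0. h (\<Phi> t p) = h (\<Phi> t p')"
  shows "\<forall>\<^sub>F t in nhds 0. apply_field full h (\<Phi> t p) = apply_field full h (\<Phi> t p')"
proof -
  have D: "((\<lambda>s. h (\<Phi> s q)) has_real_derivative apply_field full h (\<Phi> t q)) (at t)"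
    if "(q, t) \<in> W \<and> \<Phi> t q \<in> U" for q t
    unfolding apply_field_def
    using that by (intro has_derivative_along_curve[OF U _ h finite_low_coords] flow_has_derivative) auto
  \<comment> \<open>An equality near 0 holds near each small \<open>t\<close>, so it may be
    differentiated at \<open>t\<close> and not only at 0.\<close>
  have "\<forall>\<^sub>F t in nhds 0. \<forall>\<^sub>F s in nhds t. h (\<Phi> s p) = h (\<Phi> s p')"
    using eq by (simp add: eventually_eventually)
  with eventually_flow_mem[OF p(1)] eventually_flow_mem[OF p(2)] show ?thesis
  proof eventually_elim
    case (elim t)
    then show ?case
      using D DERIV_cong_ev[OF refl elim(3) refl] DERIV_unique by blast
  qed
qed

text \<open>The component \<open>c\<close> of the flow does not see the higher coordinates, so it is
  the same on both orbits; its time derivative is the coefficient.\<close>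

lemma coefficient_along_flow:
  assumes p: "p \<in> U" "p' \<in> U" "\<forall>i\<in>- higher_coords. p i = p' i" and c: "c \<in> insert X (range (\<lambda>L. Y L 0))"
  shows "\<forall>\<^sub>F t in nhds 0. full c (\<Phi> t p) = full c (\<Phi> t p')"
proof -
  have dep: "depends_only_on {p. (p, t) \<in> W} (- higher_coords) (\<lambda>p. \<Phi> t p c)" for t
    using c dep_\<Xi> dep_H by auto
  have "\<forall>\<^sub>F t in nhds 0. \<Phi> t p c = \<Phi> t p' c"
    using eventually_flow_mem[OF p(1)] eventually_flow_mem[OF p(2)]
    by eventually_elim (rule depends_only_onD[OF dep], use p(3) in auto)
  then have "\<forall>\<^sub>F t in nhds 0. \<forall>\<^sub>F s in nhds t. \<Phi> s p c = \<Phi> s p' c"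
    by (simp add: eventually_eventually)
  with eventually_flow_mem[OF p(1)] eventually_flow_mem[OF p(2)] show ?thesis
  proof eventually_elim
    case (elim t)
    then show ?case
      using flow_has_derivative DERIV_cong_ev[OF refl elim(3) refl] DERIV_unique by blast
  qed
qed

text \<open>Two points of \<open>U\<close> that differ only in \<open>Y R 2\<close> are compared
  along their orbits. One time derivative of the coefficient gives the first claim through
  \<open>vertical_eq_0\<close>, a further one gives the second.\<close>

lemma vertical_coefficient_eq_0:
  assumes "p \<in> U" and c: "c \<in> insert X (range (\<lambda>L. Y L 0))"
  shows "apply_field (vert R) (full c) p = 0"
    and "apply_field (vert R) (apply_field base (full c)) p = 0"
proof -
  have f: "C1_on U (full c)" "\<And>d. C1_on U (partial d (full c))" "depends_only_on U (- higher_coords) (full c)"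
    using c smooth[THEN C_infinity_on_imp_C1_on] C1_partial dep_\<xi> dep_\<eta> by auto
  have ex: "\<exists>s. p(Y R 2 := s) \<in> U \<and> s \<noteq> p (Y R 2)" if "p \<in> U" for p R
  proof -
    have "\<forall>\<^sub>F s in at (p (Y R 2)). p(Y R 2 := s) \<in> U \<and> s \<noteq> p (Y R 2)"
      using eventually_fun_upd_mem[OF U that, of "Y R 2"]
      by (auto simp: eventually_at_filter elim: eventually_mono)
    then show ?thesis using eventually_happens'[OF at_neq_bot] by blast
  qed
  have along: "\<forall>\<^sub>F t in nhds 0. full c (\<Phi> t p) = full c (\<Phi> t (p(Y R 2 := s)))"
    if "p \<in> U" "p(Y R 2 := s) \<in> U" for p R s
    using that c by (intro coefficient_along_flow) (auto simp: higher_coords_def)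
  have at_0: "g p = g p'" if "\<forall>\<^sub>F t in nhds 0. g (\<Phi> t p) = g (\<Phi> t p')" "p \<in> U" "p' \<in> U"
    for g :: "jet \<Rightarrow> real" and p p'
    using eventually_nhds_x_imp_x[OF that(1)] flow_0 that(2,3) by simp
  have vert: "apply_field (vert R) (full c) p = 0" if p: "p \<in> U" for p R
  proof -
    obtain s where s: "p(Y R 2 := s) \<in> U" "s \<noteq> p (Y R 2)" using ex[OF p] by blast
    show ?thesis
      using vertical_eq_0[OF f(3) p s] at_0[OF apply_field_along_flow[OF f(1,3) p s(1) along[OF p s(1)]] p s(1)] .
  qed
  then show "apply_field (vert R) (full c) p = 0" using assms(1) .
  obtain s where s: "p(Y R 2 := s) \<in> U" "s \<noteq> p (Y R 2)" using ex[OF assms(1)] by blast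
  have g: "C1_on U (apply_field base (full c))" "depends_only_on U (- higher_coords) (apply_field base (full c))"
    using f by (auto intro: C1_apply_base dep_apply dep_base)
  \<comment> \<open>With all vertical terms gone, the derivative of \<open>full c\<close> is again a
    function of the coordinates of order at most one, so the same argument applies to it.\<close>
  have reduce: "apply_field full (full c) q = apply_field base (full c) q" if "q \<in> U" for q
    using apply_field_split[OF that, of "full c"] vert[OF that] by simp
  have "\<forall>\<^sub>F t in nhds 0. apply_field base (full c) (\<Phi> t p) = apply_field base (full c) (\<Phi> t (p(Y R 2 := s)))"
    using apply_field_along_flow[OF f(1,3) assms(1) s(1) along[OF assms(1) s(1)]]
      eventually_flow_mem[OF assms(1)] eventually_flow_mem[OF s(1)]
    by eventually_elim (metis reduce)
  from at_0[OF apply_field_along_flow[OF g assms(1) s(1) this] assms(1) s(1)]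
  show "apply_field (vert R) (apply_field base (full c)) p = 0"
    by (rule vertical_eq_0[OF g(2) assms(1) s])
qed

text \<open>Taking \<open>c\<close> as \<open>X\<close> gives the conditions on \<xi>, taking it as
  \<open>Y L 0\<close> those on \<eta>.\<close>

lemma necessary_conditions:
  assumes "p \<in> U" and c: "c \<in> insert X (range (\<lambda>L. Y L 0))"
  shows "(\<Sum>P\<in>UNIV. M R P p * partial (Y P 1) (full c) p) = 0"
    and "(\<Sum>P\<in>UNIV. coefQ \<xi> \<eta> R P p * partial (Y P 1) (full c) p) = 0"
proof -
  show "(\<Sum>P\<in>UNIV. M R P p * partial (Y P 1) (full c) p) = 0"
    using vertical_coefficient_eq_0(1)[OF assms] by (simp only: apply_vertical)
  have f: "C1_on U (full c)" "\<And>d. C1_on U (partial d (full c))"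
    using c smooth[THEN C_infinity_on_imp_C1_on] C1_partial by auto
  show "(\<Sum>P\<in>UNIV. coefQ \<xi> \<eta> R P p * partial (Y P 1) (full c) p) = 0"
    using vertical_coefficient_eq_0[OF _ c] vertical_coefficient_eq_0(1)[OF assms(1), of X]
      vertical_coefficient_eq_0(1)[OF assms(1), of "Y _ 0"]
    assms(1) by (intro sum_coefQ_eq_0 f) auto
qed

end

theorem theorem8:
  fixes U :: "jet set"
    and \<xi> :: "jet \<Rightarrow> real"
    and \<eta> :: "2 \<Rightarrow> nat \<Rightarrow> jet \<Rightarrow> real"
  assumes "open U"
    and "Lie_Baecklund_on U \<xi> \<eta>"
    and "depends_only_on U (- higher_coords) \<xi>"
    and "\<And>L. depends_only_on U (- higher_coords) (\<eta> L 0)"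
    and "\<exists>W \<Phi>. exponentiable_to U \<xi> \<eta> W \<Phi> \<and>
           (\<forall>t. depends_only_on {p. (p, t) \<in> W} (- higher_coords) (\<lambda>p. \<Phi> t p X)) \<and>
           (\<forall>t L. depends_only_on {p. (p, t) \<in> W} (- higher_coords) (\<lambda>p. \<Phi> t p (Y L 0)))"
  shows "(\<forall>p\<in>U. \<forall>R.
            (\<Sum>P\<in>UNIV. coefM \<xi> \<eta> R P p * partial (Y P 1) \<xi> p) = 0 \<and>
            (\<forall>L. (\<Sum>P\<in>UNIV. coefM \<xi> \<eta> R P p * partial (Y P 1) (\<eta> L 0) p) = 0)) \<and>
         (\<forall>p\<in>U. \<forall>R.
            (\<Sum>P\<in>UNIV. coefQ \<xi> \<eta> R P p * partial (Y P 1) \<xi> p) = 0 \<and>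
            (\<forall>L. (\<Sum>P\<in>UNIV. coefQ \<xi> \<eta> R P p * partial (Y P 1) (\<eta> L 0) p) = 0))"
proof -
  obtain W \<Phi> where "exponentiable_to U \<xi> \<eta> W \<Phi>"
    "\<forall>t. depends_only_on {p. (p, t) \<in> W} (- higher_coords) (\<lambda>p. \<Phi> t p X)"
    "\<forall>t L. depends_only_on {p. (p, t) \<in> W} (- higher_coords) (\<lambda>p. \<Phi> t p (Y L 0))"
    using assms(5) by blast
  then interpret low_order_flow U \<xi> \<eta> W \<Phi>
    using assms(1-4) by unfold_locales auto
  show ?thesis
    using necessary_conditions[of _ X] necessary_conditions[of _ "Y _ 0"] by simp
qed

end
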